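(* Consider rational $c$ for which $f_c(x)=x^2+c$ has a rational $3$-cycle $\{x_1,x_2,x_3\}$ (elements written in lowest terms). (a) Some $x_i$ has numerator $\pm1$ if and only if $c\in\{-\tfrac{29}{16},\,-\tfrac{29\cdot1709}{2^6\cdot3^2\cdot7^2}\}$. (b) Some $x_i$ has numerator $\pm5$ if and only if $c\in\{-\tfrac{29}{16},\,-\tfrac{301}{2^4\cdot3^2}\}$. (c) Some $x_i$ has numerator $\pm7$ if and only if $c\in\{-\tfrac{29}{16},\,-\tfrac{6469}{2^4\cdot3^2\cdot5^2}\}$. *)

theory Defs
  imports Complex_Main
begin

definition fc :: "rat \<Rightarrow> rat \<Rightarrow> rat" where
  "fc c x = x ^ 2 + c"

definition rat_3cycle :: "rat \<Rightarrow> rat \<Rightarrow> rat \<Rightarrow> rat \<Rightarrow> bool" where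
  "rat_3cycle c x1 x2 x3 \<longleftrightarrow>
     x1 \<noteq> x2 \<and> x2 \<noteq> x3 \<and> x1 \<noteq> x3 \<and>
     fc c x1 = x2 \<and> fc c x2 = x3 \<and> fc c x3 = x1"

definition num :: "rat \<Rightarrow> int" where
  "num x = fst (quotient_of x)"

definition cycle_has_num :: "rat \<Rightarrow> int \<Rightarrow> bool" where
  "cycle_has_num c m \<longleftrightarrow>
     (\<exists>x1 x2 x3. rat_3cycle c x1 x2 x3 \<and> (\<exists>x\<in>{x1, x2, x3}. \<bar>num x\<bar> = m))"

end

theory Submission
  imports Defs "HOL-Number_Theory.Cong"
begin

text \<open>If \<open>x\<close>, \<open>y\<close>, \<open>z\<close> is a rational 3-cycle and \<open>x + y = a / b\<close> in lowest terms, then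
  \<open>y = F / (2 * a * b * (a + b))\<close> with \<open>F = a ^ 3 - a * b\<^sup>2 - b ^ 3\<close>, and this fraction is
  reduced. So the numerator is, up to sign, the norm of \<open>a - b * \<theta>\<close>, where \<open>\<theta> ^ 3 = \<theta> + 1\<close>.
  The units of norm 1 of \<open>\<int>[\<theta>]\<close> are the powers of \<open>\<theta>\<close>, and an element \<open>a - b * \<theta>\<close> of norm 5 or 7
  is divisible by \<open>2 - \<theta>\<close> or \<open>2 + \<theta>\<close>. It remains to find the \<open>n\<close> for which \<open>\<gamma> * \<theta> ^ n\<close> has no
  \<open>\<theta>\<^sup>2\<close> term, with \<open>\<gamma>\<close> one of \<open>1\<close>, \<open>2 - \<theta>\<close>, \<open>2 + \<theta>\<close>. Skolem's method settles this with the prime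
  59, which splits completely, so that \<open>\<theta> ^ 58\<close> is congruent to 1 modulo 59.\<close>

section \<open>The ring of integers of the cubic field of discriminant -23\<close>

text \<open>\<open>Plastic u v w\<close> stands for u + v \<theta> + w \<theta>^2; the product
  defined below reduces by \<theta>^3 = \<theta> + 1 and \<theta>^4 = \<theta>^2 + \<theta>.\<close>

datatype plastic = Plastic (c0: int) (c1: int) (c2: int)

instantiation plastic :: comm_ring_1
begin

definition "0 = Plastic 0 0 0"
definition "1 = Plastic 1 0 0"
definition "- x = Plastic (- c0 x) (- c1 x) (- c2 x)"
definition "x + y = Plastic (c0 x + c0 y) (c1 x + c1 y) (c2 x + c2 y)"
definition "x - y = Plastic (c0 x - c0 y) (c1 x - c1 y) (c2 x - c2 y)"
definition "x * y = Plastic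
  (c0 x * c0 y + c1 x * c2 y + c2 x * c1 y)
  (c0 x * c1 y + c1 x * c0 y + c1 x * c2 y + c2 x * c1 y + c2 x * c2 y)
  (c0 x * c2 y + c1 x * c1 y + c2 x * c0 y + c2 x * c2 y)"

instance
  by standard
    (auto simp: zero_plastic_def one_plastic_def uminus_plastic_def plus_plastic_def
      minus_plastic_def times_plastic_def algebra_simps intro: plastic.expand)

end

lemma plastic_sel_simps [simp]:
  "c0 0 = 0" "c1 0 = 0" "c2 0 = 0"
  "c0 1 = 1" "c1 1 = 0" "c2 1 = 0"
  "c0 (x + y) = c0 x + c0 y" "c1 (x + y) = c1 x + c1 y" "c2 (x + y) = c2 x + c2 y"
  by (simp_all add: zero_plastic_def one_plastic_def plus_plastic_def)

lemma plastic_of_int: "of_int k = Plastic k 0 0"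
proof -
  have "of_nat n = Plastic (int n) 0 0" for n
    by (induction n) (simp_all add: zero_plastic_def one_plastic_def plus_plastic_def)
  then show ?thesis
    by (cases k rule: int_cases2) (simp_all add: uminus_plastic_def)
qed

lemma c2_of_int_mult [simp]: "c2 (of_int k * x) = k * c2 x"
  by (simp add: plastic_of_int times_plastic_def)

section \<open>The unit \<open>theta\<close>, its integer powers and the norm form\<close>

definition theta :: plastic where "theta = Plastic 0 1 0"
definition theta_inv :: plastic where "theta_inv = Plastic (- 1) 0 1"

lemma theta_inverse: "theta * theta_inv = 1"
  by (simp add: theta_def theta_inv_def times_plastic_def one_plastic_def)

definition theta_pow :: "int \<Rightarrow> plastic" where
  "theta_pow n = (if n \<ge> 0 then theta ^ nat n else theta_inv ^ nat (- n))"

lemma theta_pow_0 [simp]: "theta_pow 0 = 1"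
  by (simp add: theta_pow_def)

lemma theta_pow_Suc: "theta_pow (n + 1) = theta_pow n * theta"
proof (cases "n \<ge> 0")
  case True
  then show ?thesis by (simp add: theta_pow_def nat_add_distrib mult.commute)
next
  case False
  then obtain k where k: "n = - int (Suc k)"
    by (metis int_cases negative_zle_0 not_le of_nat_0_le_iff)
  have "theta_pow (n + 1) = theta_inv ^ k"
    by (cases k) (simp_all add: k theta_pow_def nat_add_distrib)
  also have "\<dots> = theta_inv ^ k * (theta * theta_inv)"
    by (simp add: theta_inverse)
  also have "\<dots> = theta_inv ^ Suc k * theta"
    by (simp add: ac_simps)
  finally show ?thesis
    unfolding k by (simp add: theta_pow_def nat_add_distrib)
qed

lemma theta_pow_add: "theta_pow (m + n) = theta_pow m * theta_pow n"
proof (induction n rule: int_induct[where k = 0])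
  case base
  then show ?case by simp
next
  case (step1 n)
  then show ?case
    using theta_pow_Suc[of "m + n"] theta_pow_Suc[of n] by (simp add: algebra_simps)
next
  case (step2 n)
  have "theta_pow (m + n - 1) * theta = theta_pow m * theta_pow (n - 1) * theta"
    using theta_pow_Suc[of "m + n - 1"] theta_pow_Suc[of "n - 1"] step2
    by (simp add: algebra_simps)
  then have "theta_pow (m + n - 1) * (theta * theta_inv)
      = theta_pow m * theta_pow (n - 1) * (theta * theta_inv)"
    by (metis mult.assoc)
  then show ?case by (simp add: theta_inverse algebra_simps)
qed

text \<open>The determinant of multiplication by \<open>z\<close> in the basis 1, \<theta>,
  \<theta>^2, that is, the product of the three conjugates of \<open>z\<close>.\<close>

definition norm_plastic :: "plastic \<Rightarrow> int" where
  "norm_plastic z = (let u = c0 z; v = c1 z; w = c2 z in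
     u ^ 3 + v ^ 3 + w ^ 3 + 2 * u ^ 2 * w - u * v ^ 2 + u * w ^ 2 - v * w ^ 2 - 3 * u * v * w)"

lemma norm_plastic_mult: "norm_plastic (x * y) = norm_plastic x * norm_plastic y"
  unfolding norm_plastic_def Let_def times_plastic_def plastic.sel by algebra

lemma norm_theta_pow: "norm_plastic (theta_pow n) = 1"
proof -
  have 1: "norm_plastic 1 = 1" "norm_plastic theta = 1" "norm_plastic theta_inv = 1"
    by (simp_all add: norm_plastic_def one_plastic_def theta_def theta_inv_def)
  have "norm_plastic (x ^ k) = 1" if "norm_plastic x = 1" for x k
    by (induction k) (simp_all add: 1 that norm_plastic_mult)
  then show ?thesis by (simp add: theta_pow_def 1)
qed

section \<open>Units of norm one\<close>

definition embed :: "real \<Rightarrow> plastic \<Rightarrow> real" where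
  "embed t z = of_int (c0 z) + of_int (c1 z) * t + of_int (c2 z) * t ^ 2"

context
  fixes t :: real
  assumes root: "t ^ 3 = t + 1"
begin

lemma embed_mult: "embed t (x * y) = embed t x * embed t y"
  using root unfolding embed_def times_plastic_def plastic.sel of_int_add of_int_mult by algebra

lemma embed_one [simp]: "embed t 1 = 1"
  by (simp add: embed_def)

lemma embed_theta [simp]: "embed t theta = t"
  by (simp add: embed_def theta_def)

text \<open>The second factor is the squared modulus of the image of \<open>z\<close> under the complex
  embedding, whose root has real part \<open>- t / 2\<close> and squared imaginary part \<open>3 * t\<^sup>2 / 4 - 1\<close>.\<close>

lemma norm_eq_embed:
  "real_of_int (norm_plastic z) = embed t z *
     ((of_int (c0 z) - of_int (c1 z) * t / 2 + of_int (c2 z) * (1 - t ^ 2 / 2)) ^ 2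
      + (of_int (c1 z) - of_int (c2 z) * t) ^ 2 * (3 * t ^ 2 / 4 - 1))"
  (is "_ = _ * ?Q")
proof -
  have "4 * real_of_int (norm_plastic z) = 4 * (embed t z * ?Q)"
    using root unfolding norm_plastic_def Let_def embed_def
    by (simp add: power_divide field_simps) algebra
  then show ?thesis by simp
qed

text \<open>For \<open>s > 6 / 5\<close> the cofactor of \<open>s - t\<close> in
  \<open>s ^ 3 - s - 1\<close> is positive, so the sign of the cubic at \<open>s\<close> decides on
  which side of \<open>t\<close> the number \<open>s\<close> lies.\<close>

lemma root_bounds: "331 / 250 < t" "t < 53 / 40"
proof -
  have pos: "s ^ 2 + s * t + t ^ 2 - 1 > 0" if "s > 6 / 5" for s :: real
  proof -
    have "s ^ 2 > (6 / 5) ^ 2" using that by (intro power_strict_mono) auto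
    then have "s ^ 2 > 4 / 3" by (simp add: power_divide)
    moreover have "s ^ 2 + s * t + t ^ 2 - 1 = (s / 2 + t) ^ 2 + 3 / 4 * s ^ 2 - 1"
      by (simp add: power2_eq_square field_simps)
    ultimately show ?thesis
      using zero_le_power2[of "s / 2 + t"] by linarith
  qed
  have fact: "s ^ 3 - s - 1 = (s - t) * (s ^ 2 + s * t + t ^ 2 - 1)" for s :: real
    using root by algebra
  have "(331 / 250 - t) * ((331 / 250) ^ 2 + 331 / 250 * t + t ^ 2 - 1) < 0"
    unfolding fact[symmetric] by (simp add: power3_eq_cube)
  then show "331 / 250 < t"
    using pos[of "331 / 250"] by (simp add: mult_less_0_iff)
  have "0 < (53 / 40 - t) * ((53 / 40) ^ 2 + 53 / 40 * t + t ^ 2 - 1)"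
    unfolding fact[symmetric] by (simp add: power3_eq_cube)
  then show "t < 53 / 40"
    using pos[of "53 / 40"] by (simp add: zero_less_mult_iff)
qed

lemma root_square_bounds: "219 / 125 < t ^ 2" "t ^ 2 < 439 / 250"
proof -
  have "(331 / 250) ^ 2 < t ^ 2" using root_bounds by (intro power_strict_mono) auto
  then show "219 / 125 < t ^ 2" by (simp add: power2_eq_square)
  have "t ^ 2 < (53 / 40) ^ 2" using root_bounds by (intro power_strict_mono) auto
  then show "t ^ 2 < 439 / 250" by (simp add: power2_eq_square)
qed

text \<open>The norm is the real embedding \<open>B\<close> times the squared modulus of a complex
  conjugate. As \<open>B\<close> is at least 1, that modulus is at most 1. All conjugates are thus
  bounded, which leaves finitely many coordinates to examine.\<close>

lemma unit_in_fundamental_domain: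
  assumes norm: "norm_plastic z = 1" and ge: "1 \<le> embed t z" and lt: "embed t z < t"
  shows "z = 1"
proof -
  obtain u v w where z: "z = Plastic u v w" by (cases z)
  define A where "A = of_int u - of_int v * t / 2 + of_int w * (1 - t ^ 2 / 2)"
  define E where "E = of_int v - of_int w * t"
  define B where "B = of_int u + of_int v * t + of_int w * t ^ 2"
  define q where "q = 3 * t ^ 2 / 4 - 1"
  have q: "5 / 16 < q" using root_square_bounds by (simp add: q_def)
  have B: "1 \<le> B" "B < 53 / 40"
    using ge lt root_bounds by (auto simp: B_def embed_def z)
  have "B * (A ^ 2 + E ^ 2 * q) = 1"
    using norm_eq_embed[of z] norm by (simp add: A_def B_def E_def q_def embed_def z)
  moreover have "A ^ 2 + E ^ 2 * q \<ge> 0" using q by simp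
  ultimately have le: "A ^ 2 + E ^ 2 * q \<le> 1"
    using mult_right_mono[OF B(1)] by fastforce
  moreover have "E ^ 2 * q \<ge> 0" using q by simp
  ultimately have "A ^ 2 \<le> 1" by linarith
  then have A: "\<bar>A\<bar> \<le> 1" by (simp add: abs_square_le_1)
  have "E ^ 2 * (5 / 16) \<le> E ^ 2 * q" using q by (intro mult_left_mono) auto
  then have "E ^ 2 \<le> 16 / 5" using le zero_le_power2[of A] by linarith
  then have "E ^ 2 \<le> (9 / 5) ^ 2" by (simp add: power_divide)
  then have E: "\<bar>E\<bar> \<le> 9 / 5" using abs_le_square_iff[of E "9 / 5"] by simp
  have Et: "\<bar>E * t\<bar> \<le> 9 / 5 * (53 / 40)"
    unfolding abs_mult using E root_bounds by (intro mult_mono) auto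
  \<comment> \<open>Eliminating \<open>u\<close> and \<open>v\<close> isolates \<open>w\<close>. Its
    coefficient, the derivative of the cubic at \<open>t\<close>, exceeds 17/4, so the bounds leave
    only 0 and 1.\<close>
  have "w * (3 * t ^ 2 - 1) = B - A - 3 / 2 * (E * t)"
    by (simp add: A_def B_def E_def algebra_simps power2_eq_square)
  then have wb: "- 18 / 5 \<le> w * (3 * t ^ 2 - 1)" "w * (3 * t ^ 2 - 1) \<le> 6"
    using A B Et by linarith+
  have "w < 2"
  proof (rule ccontr)
    assume "\<not> w < 2"
    then have "2 * (17 / 4) \<le> w * (3 * t ^ 2 - 1)"
      using root_square_bounds by (intro mult_mono) auto
    then show False using wb by simp
  qed
  moreover have "w > -1"
  proof (rule ccontr)
    assume "\<not> w > -1"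
    then have "1 * (17 / 4) \<le> (- w) * (3 * t ^ 2 - 1)"
      using root_square_bounds by (intro mult_mono) auto
    then show False using wb by simp
  qed
  ultimately consider "w = 0" | "w = 1" by linarith
  then show ?thesis
  proof cases
    case 1
    have "v = -1 \<or> v = 0 \<or> v = 1"
      using E by (simp add: E_def 1) linarith
    moreover have "v \<noteq> -1"
    proof
      assume "v = -1"
      then have "2 < real_of_int u" "real_of_int u < 3"
        using B root_bounds by (simp_all add: B_def 1)
      then have "2 < u" "u < 3" by simp_all
      then show False by simp
    qed
    \<comment> \<open>For \<open>v = 1\<close> the lower bound gives \<open>u \<ge> 0\<close>, and
      the strict bound \<open>lt\<close> excludes this; \<open>theta\<close> itself lies on that
      boundary.\<close>
    ultimately have "u = 1 \<and> v = 0"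
      using B root_bounds lt by (auto simp: B_def 1 embed_def z)
    then show ?thesis by (simp add: z 1 one_plastic_def)
  next
    case 2
    have "\<bar>real_of_int v - t\<bar> \<le> 9 / 5" using E by (simp add: E_def 2)
    then have "-1 < real_of_int v" "real_of_int v < 4"
      using root_bounds by linarith+
    then have "v = 0 \<or> v = 1 \<or> v = 2 \<or> v = 3" by linarith
    moreover have "v \<noteq> 0"
    proof
      assume "v = 0"
      then have "-1 < real_of_int u" "real_of_int u < 0"
        using B root_square_bounds by (simp_all add: B_def 2)
      then have "-1 < u" "u < 0" by simp_all
      then show False by simp
    qed
    moreover have "v \<noteq> 2"
    proof
      assume "v = 2"
      then have "-4 < real_of_int u" "real_of_int u < -3"
        using B root_bounds root_square_bounds by (simp_all add: B_def 2)
      then have "-4 < u" "u < -3" by simp_all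
      then show False by simp
    qed
    moreover have "v \<noteq> 3"
    proof
      assume "v = 3"
      then have "-5 < real_of_int u" "real_of_int u < -4"
        using B root_bounds root_square_bounds by (simp_all add: B_def 2)
      then have "-5 < u" "u < -4" by simp_all
      then show False by simp
    qed
    ultimately have v: "v = 1" by blast
    then have "-3 < real_of_int u" "real_of_int u < -1"
      using B root_bounds root_square_bounds by (simp_all add: B_def 2)
    then have "-3 < u" "u < -1" by simp_all
    then have "u = -2" by simp
    \<comment> \<open>The size bounds admit -2 + \<theta> + \<theta>^2, but its norm is 7.\<close>
    then have False
      using norm by (simp add: norm_plastic_def z 2 v)
    then show ?thesis ..
  qed
qed

lemma embed_theta_pow: "embed t (theta_pow n) = t powi n"
proof -
  have "t * embed t theta_inv = 1"
    using embed_mult[of theta theta_inv] by (simp add: theta_inverse)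
  then have inv: "embed t theta_inv = inverse t"
    by (metis inverse_unique)
  have "embed t (z ^ k) = embed t z ^ k" for z k
    by (induction k) (simp_all add: embed_mult)
  then show ?thesis
    by (simp add: theta_pow_def power_int_def inv)
qed

end

section \<open>Reduction of units to the fundamental domain\<close>

lemma real_root_exists: "\<exists>t::real. t ^ 3 = t + 1"
proof -
  have "\<exists>t\<ge>1. t \<le> 2 \<and> t ^ 3 - t = (1::real)"
    by (intro IVT') (auto intro!: continuous_intros)
  then show ?thesis by (metis add.commute diff_add_cancel)
qed

text \<open>Multiplication by a suitable power of \<open>theta\<close> moves the real embedding into
  the interval from 1 (included) to \<open>t\<close> (excluded), where 1 is the only element of norm
  1.\<close>

lemma unit_eq_theta_pow:
  assumes "norm_plastic z = 1"
  shows "\<exists>n. z = theta_pow n"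
proof -
  obtain t :: real where root: "t ^ 3 = t + 1"
    using real_root_exists by blast
  note t = root_bounds[OF root]
  have "0 \<le> 3 * t ^ 2 / 4 - 1"
    using root_square_bounds[OF root] by simp
  \<comment> \<open>The second factor of the norm is nonnegative, so norm 1 forces a positive
    embedding, whose logarithm then gives \<open>n\<close>.\<close>
  then have pos: "embed t z > 0"
    using norm_eq_embed[OF root, of z] assms
    by (smt (verit) mult_nonneg_nonneg mult_nonpos_nonneg of_int_1 zero_le_power2)
  define n where "n = \<lfloor>log t (embed t z)\<rfloor>"
  have n: "t powi n \<le> embed t z" "embed t z < t powi (n + 1)"
  proof -
    have "t powr n \<le> t powr (log t (embed t z))" "t powr (log t (embed t z)) < t powr (n + 1)"
      unfolding n_def using t by (auto intro!: powr_mono powr_less_mono)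
    then show "t powi n \<le> embed t z" "embed t z < t powi (n + 1)"
      using t pos by (simp_all flip: powr_real_of_int')
  qed
  define y where "y = z * theta_pow (- n)"
  have y: "embed t y = embed t z / t powi n"
    by (simp add: y_def embed_mult[OF root] embed_theta_pow[OF root] power_int_minus divide_inverse)
  have "y = 1"
  proof (rule unit_in_fundamental_domain[OF root])
    show "norm_plastic y = 1"
      using assms by (simp add: y_def norm_plastic_mult norm_theta_pow)
    show "1 \<le> embed t y" "embed t y < t"
      using n t by (auto simp: y field_simps power_int_add)
  qed
  moreover have "z = y * theta_pow n"
    using theta_pow_add[of "- n" n] by (simp add: y_def mult.assoc)
  ultimately show ?thesis by auto
qed

section \<open>Skolem's method\<close>

lemma binomial_expansion_mod:
  fixes x :: "'a::comm_ring_1"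
  shows "\<exists>y. (1 + x) ^ n = 1 + of_nat n * x + of_nat (n choose 2) * x ^ 2 + x ^ 3 * y"
proof (induction n)
  case 0
  then show ?case by (intro exI[of _ 0]) (simp add: numeral_2_eq_2)
next
  case (Suc n)
  then obtain y where "(1 + x) ^ n = 1 + of_nat n * x + of_nat (n choose 2) * x ^ 2 + x ^ 3 * y"
    by blast
  then have "(1 + x) ^ Suc n
      = 1 + of_nat (Suc n) * x + of_nat (Suc n choose 2) * x ^ 2
        + x ^ 3 * (of_nat (n choose 2) + y + x * y)"
    by (simp add: numeral_2_eq_2 numeral_3_eq_3 algebra_simps)
  then show ?case by blast
qed

text \<open>Each p-th power contributes one more factor p to the deviation from 1 and keeps its
  leading coefficient \<open>x\<close> modulo p. Since p is odd, it divides
  \<open>p choose 2\<close>, which pushes the quadratic term into the error.\<close>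

lemma prime_power_expansion:
  fixes x :: "'a::comm_ring_1" and p :: nat
  assumes "odd p"
  shows "\<exists>y. (1 + of_nat p * x) ^ (p ^ k) = 1 + of_nat (p ^ Suc k) * (x + of_nat p * y)"
proof (induction k)
  case 0
  show ?case by (intro exI[of _ 0]) simp
next
  case (Suc k)
  then obtain y where y:
    "(1 + of_nat p * x) ^ (p ^ k) = 1 + of_nat (p ^ Suc k) * (x + of_nat p * y)" (is "_ = 1 + ?P * ?z")
    by blast
  obtain h where h: "p choose 2 = p * h"
  proof -
    obtain b where "p = 2 * b + 1" using assms by (rule oddE)
    then show ?thesis by (intro that[of b]) (simp add: choose_two)
  qed
  obtain w where w:
    "(1 + ?P * ?z) ^ p = 1 + of_nat p * (?P * ?z) + of_nat (p choose 2) * (?P * ?z) ^ 2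
      + (?P * ?z) ^ 3 * w"
    using binomial_expansion_mod by blast
  have "(1 + of_nat p * x) ^ (p ^ Suc k) = ((1 + of_nat p * x) ^ (p ^ k)) ^ p"
    by (simp add: mult.commute flip: power_mult)
  also have "\<dots> = (1 + ?P * ?z) ^ p"
    by (simp only: y)
  also have "\<dots> = 1 + of_nat (p ^ Suc (Suc k))
      * (x + of_nat p * (y + of_nat h * of_nat (p ^ k) * ?z ^ 2 + of_nat (p ^ k) ^ 2 * ?z ^ 3 * w))"
    unfolding w h by (simp add: algebra_simps power2_eq_square power3_eq_cube)
  finally show ?case by blast
qed

text \<open>Write m = p^k j with p not dividing j. The power is 1 + p^(k+1) (j x + p e), so by
  \<open>c2 a = 0\<close> the coefficient is p^(k+1) times an integer congruent to
  \<open>j * c2 (a * x)\<close>, which is nonzero modulo p.\<close>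

lemma skolem_nonzero:
  fixes p :: nat and a x :: plastic
  assumes p: "prime p" "odd p" and a: "c2 a = 0" and ndvd: "\<not> int p dvd c2 (a * x)" and "m > 0"
  shows "c2 (a * (1 + of_nat p * x) ^ m) \<noteq> 0"
proof -
  have "m \<noteq> 0" "\<not> is_unit p"
    using assms not_prime_unit by auto
  then obtain j where m: "m = p ^ multiplicity p m * j" and j: "\<not> p dvd j"
    by (rule multiplicity_decompose')
  define k where "k = multiplicity p m"
  obtain y where y:
    "(1 + of_nat p * x) ^ (p ^ k) = 1 + of_nat (p ^ Suc k) * (x + of_nat p * y)" (is "_ = 1 + ?P * ?z")
    using prime_power_expansion[OF p(2)] by blast
  obtain w where w:
    "(1 + ?P * ?z) ^ j = 1 + of_nat j * (?P * ?z) + of_nat (j choose 2) * (?P * ?z) ^ 2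
      + (?P * ?z) ^ 3 * w"
    using binomial_expansion_mod by blast
  \<comment> \<open>All terms of the expansion other than 1 and \<open>?P * j * x\<close>, divided
    by \<open>?P * p\<close>.\<close>
  define e where "e = of_nat j * y + of_nat (j choose 2) * of_nat (p ^ k) * ?z ^ 2
    + of_nat (p ^ k) * ?P * ?z ^ 3 * w"
  have "(1 + of_nat p * x) ^ m = ((1 + of_nat p * x) ^ (p ^ k)) ^ j"
    using m unfolding k_def by (metis power_mult)
  also have "\<dots> = (1 + ?P * ?z) ^ j"
    by (simp only: y)
  also have "\<dots> = 1 + ?P * (of_nat j * x + of_nat p * e)"
    unfolding w e_def by (simp add: algebra_simps power2_eq_square power3_eq_cube)
  finally have "a * (1 + of_nat p * x) ^ m
      = a + of_int (int (p ^ Suc k)) * (of_int (int j) * (a * x) + of_int (int p) * (a * e))"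
    by (simp add: algebra_simps)
  then have "c2 (a * (1 + of_nat p * x) ^ m)
      = int (p ^ Suc k) * (int j * c2 (a * x) + int p * c2 (a * e))"
    by (simp only: plastic_sel_simps c2_of_int_mult a)
  moreover have "\<not> int p dvd int j * c2 (a * x) + int p * c2 (a * e)"
    using p j ndvd by (simp add: dvd_add_left_iff prime_dvd_mult_iff)
  then have "int j * c2 (a * x) + int p * c2 (a * e) \<noteq> 0" by auto
  ultimately show ?thesis using p by auto
qed

section \<open>The period 58 modulo 59\<close>

definition xi_pos :: plastic where "xi_pos = Plastic 36333 63760 48131"
definition xi_neg :: plastic where "xi_neg = Plastic (- 48) 19 13"

text \<open>Both directions are recorded because \<open>skolem_nonzero\<close> takes a natural
  exponent, so negative multiples of 58 are reached through powers of
  \<open>theta_inv ^ 58\<close>.\<close>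

lemma theta_power_58: "theta ^ 58 = 1 + of_nat 59 * xi_pos" "theta_inv ^ 58 = 1 + of_nat 59 * xi_neg"
  by code_simp+

lemma theta_pow_period:
  "theta_pow (58 * q) = (1 + of_nat 59 * (if q \<ge> 0 then xi_pos else xi_neg)) ^ nat \<bar>q\<bar>"
proof -
  have "nat (58 * k) = 58 * nat k" for k :: int by simp
  from this[of q] this[of "- q"] show ?thesis
    by (simp add: theta_pow_def power_mult theta_power_58 zero_le_mult_iff)
qed

text \<open>Modulo 59 the coefficient vanishes only at the residues of the indices \<open>zs\<close>;
  on each of these residue classes Skolem's argument shows that it vanishes only once.\<close>

lemma c2_zero_index:
  assumes zero: "c2 (g * theta_pow n) = 0"
    and residues: "list_all (\<lambda>r. 59 dvd c2 (g * theta ^ r) \<longrightarrow>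
      list_ex (\<lambda>z. z mod 58 = int r) zs) [0..<58]"
    and zs: "list_all (\<lambda>z. c2 (g * theta_pow z) = 0 \<and>
      \<not> 59 dvd c2 (g * theta_pow z * xi_pos) \<and> \<not> 59 dvd c2 (g * theta_pow z * xi_neg)) zs"
  shows "n \<in> set zs"
proof -
  define r where "r = nat (n mod 58)"
  have r: "r < 58" "int r = n mod 58" by (auto simp: r_def nat_less_iff)
  define x where "x = (if n div 58 \<ge> 0 then xi_pos else xi_neg)"
  \<comment> \<open>Modulo 59 this power is 1, so the coefficient modulo 59 depends only on
    \<open>n mod 58\<close>.\<close>
  obtain y where "theta_pow (58 * (n div 58)) = 1 + of_nat 59 * y"
  proof -
    obtain y where y: "theta_pow (58 * (n div 58))
      = 1 + of_nat (nat \<bar>n div 58\<bar>) * (of_nat 59 * x)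
        + of_nat (nat \<bar>n div 58\<bar> choose 2) * (of_nat 59 * x) ^ 2 + (of_nat 59 * x) ^ 3 * y"
      unfolding theta_pow_period x_def[symmetric]
      using binomial_expansion_mod by blast
    show ?thesis
      by (rule that[of "of_nat (nat \<bar>n div 58\<bar>) * x
          + of_nat (nat \<bar>n div 58\<bar> choose 2) * of_nat 59 * x ^ 2 + of_nat 59 ^ 2 * x ^ 3 * y"],
          unfold y) (simp add: power2_eq_square power3_eq_cube algebra_simps)
  qed
  moreover have "theta_pow n = theta ^ r * theta_pow (58 * (n div 58))"
    using theta_pow_add[of "int r" "58 * (n div 58)"] r by (simp add: theta_pow_def r_def)
  ultimately have "g * theta_pow n = g * theta ^ r + of_int 59 * (g * theta ^ r * y)"
    by (simp add: algebra_simps)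
  then have "c2 (g * theta ^ r) = 59 * - c2 (g * theta ^ r * y)"
    using zero by (simp only: plastic_sel_simps c2_of_int_mult)
  then have "59 dvd c2 (g * theta ^ r)" by (metis dvd_triv_left)
  then obtain z where z: "z \<in> set zs" "z mod 58 = n mod 58"
    using residues r by (auto simp: list_all_iff list_ex_iff)
  then obtain q where q: "n = z + 58 * q"
    by (metis mod_eqE)
  have "q = 0"
  proof (rule ccontr)
    assume "q \<noteq> 0"
    \<comment> \<open>The coefficient vanishes at \<open>z\<close>, so it cannot vanish again at a
      nonzero multiple of 58 away from \<open>z\<close>.\<close>
    then have "c2 (g * theta_pow z * theta_pow (58 * q)) \<noteq> 0"
      unfolding theta_pow_period using zs z
      by (intro skolem_nonzero) (auto simp: list_all_iff)
    then show False
      using zero by (simp add: q theta_pow_add mult.assoc)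
  qed
  then show ?thesis using z q by simp
qed

section \<open>The cubic Thue equations\<close>

lemma norm_linear: "norm_plastic (Plastic a (- b) 0) = a ^ 3 - a * b ^ 2 - b ^ 3"
  by (simp add: norm_plastic_def)

text \<open>Here a - b \<theta> is a power of \<open>theta\<close> without \<theta>^2 term. Three of
  the five solutions have a b (a + b) = 0 and come from no cycle.\<close>

lemma thue_1:
  fixes a b :: int
  assumes "a ^ 3 - a * b ^ 2 - b ^ 3 = 1"
  shows "(a, b) \<in> {(4, 3), (-1, -1), (1, 0), (0, -1), (1, -1)}"
proof -
  obtain n where n: "Plastic a (- b) 0 = theta_pow n"
    using unit_eq_theta_pow assms by (metis norm_linear)
  have "n \<in> set [-13, -4, 0, 1, 3]"
    by (rule c2_zero_index[where g = 1], simp flip: n, code_simp, code_simp)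
  moreover have "map theta_pow [-13, -4, 0, 1, 3] = [Plastic 4 (-3) 0, Plastic (-1) 1 0,
      Plastic 1 0 0, Plastic 0 1 0, Plastic 1 1 0]"
    by code_simp
  ultimately show ?thesis using n by (auto simp: one_plastic_def)
qed

text \<open>Modulo 5 the form vanishes only where a is congruent to 2b. This makes a - b \<theta>
  divisible by 2 - \<theta>, of norm 5, and the cofactor is a unit of norm 1.\<close>

lemma thue_5:
  fixes a b :: int
  assumes eq: "a ^ 3 - a * b ^ 2 - b ^ 3 = 5"
  shows "(a, b) \<in> {(2, 1), (1, -2)}"
proof -
  have "[(a mod 5) ^ 3 - (a mod 5) * (b mod 5) ^ 2 - (b mod 5) ^ 3
      = a ^ 3 - a * b ^ 2 - b ^ 3] (mod 5)"
    by (intro cong_diff cong_mult cong_pow) (simp_all add: cong_def)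
  then have "((a mod 5) ^ 3 - (a mod 5) * (b mod 5) ^ 2 - (b mod 5) ^ 3) mod 5 = 0"
    by (simp add: eq cong_def)
  moreover have "a mod 5 \<in> {0..<5}" "b mod 5 \<in> {0..<5}" by auto
  then have "a mod 5 \<in> {0,1,2,3,4}" "b mod 5 \<in> {0,1,2,3,4}" by auto
  ultimately have "(a mod 5 - 2 * (b mod 5)) mod 5 = 0" by auto
  then have "5 dvd a - 2 * b" by presburger
  then obtain k where k: "a = 2 * b + 5 * k" by (metis diff_eq_eq add.commute dvdE)
  \<comment> \<open>From 5 = (2 - \<theta>)(3 + 2 \<theta> + \<theta>^2) and a - b \<theta> = b (2 -
    \<theta>) + 5k.\<close>
  have prod: "Plastic a (- b) 0 = Plastic 2 (-1) 0 * Plastic (b + 3 * k) (2 * k) k"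
    by (simp add: times_plastic_def k)
  have "norm_plastic (Plastic 2 (-1) 0) * norm_plastic (Plastic (b + 3 * k) (2 * k) k) = 5"
    using eq norm_linear[of a b] by (simp only: prod norm_plastic_mult)
  then have "norm_plastic (Plastic (b + 3 * k) (2 * k) k) = 1"
    by (simp add: norm_plastic_def)
  then obtain n where n: "Plastic a (- b) 0 = Plastic 2 (-1) 0 * theta_pow n"
    using prod unit_eq_theta_pow by metis
  have "n \<in> set [0, 6]"
    by (rule c2_zero_index[where g = "Plastic 2 (-1) 0"], simp flip: n, code_simp, code_simp)
  moreover have "map (\<lambda>n. Plastic 2 (-1) 0 * theta_pow n) [0, 6] = [Plastic 2 (-1) 0, Plastic 1 2 0]"
    by code_simp
  ultimately show ?thesis using n by auto
qed

text \<open>As for 5, with 2 + \<theta> of norm 7: modulo 7 the form vanishes only where a is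
  congruent to -2b.\<close>

lemma thue_7:
  fixes a b :: int
  assumes eq: "a ^ 3 - a * b ^ 2 - b ^ 3 = 7"
  shows "(a, b) \<in> {(3, 2), (2, -1)}"
proof -
  have "[(a mod 7) ^ 3 - (a mod 7) * (b mod 7) ^ 2 - (b mod 7) ^ 3
      = a ^ 3 - a * b ^ 2 - b ^ 3] (mod 7)"
    by (intro cong_diff cong_mult cong_pow) (simp_all add: cong_def)
  then have "((a mod 7) ^ 3 - (a mod 7) * (b mod 7) ^ 2 - (b mod 7) ^ 3) mod 7 = 0"
    by (simp add: eq cong_def)
  moreover have "a mod 7 \<in> {0..<7}" "b mod 7 \<in> {0..<7}" by auto
  then have "a mod 7 \<in> {0,1,2,3,4,5,6}" "b mod 7 \<in> {0,1,2,3,4,5,6}" by auto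
  ultimately have "(a mod 7 + 2 * (b mod 7)) mod 7 = 0" by auto
  then have "7 dvd a + 2 * b" by presburger
  then obtain k where k: "a = - 2 * b + 7 * k" by (metis eq_diff_eq mult_minus_left uminus_add_conv_diff dvdE add.commute)
  \<comment> \<open>From 7 = (2 + \<theta>)(3 - 2 \<theta> + \<theta>^2) and a - b \<theta> = -b (2
    + \<theta>) + 7k.\<close>
  have prod: "Plastic a (- b) 0 = Plastic 2 1 0 * Plastic (- b + 3 * k) (- 2 * k) k"
    by (simp add: times_plastic_def k)
  have "norm_plastic (Plastic 2 1 0) * norm_plastic (Plastic (- b + 3 * k) (- 2 * k) k) = 7"
    using eq norm_linear[of a b] by (simp only: prod norm_plastic_mult)
  then have "norm_plastic (Plastic (- b + 3 * k) (- 2 * k) k) = 1"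
    by (simp add: norm_plastic_def)
  then obtain n where n: "Plastic a (- b) 0 = Plastic 2 1 0 * theta_pow n"
    using prod unit_eq_theta_pow by metis
  have "n \<in> set [-8, 0]"
    by (rule c2_zero_index[where g = "Plastic 2 1 0"], simp flip: n, code_simp, code_simp)
  moreover have "map (\<lambda>n. Plastic 2 1 0 * theta_pow n) [-8, 0] = [Plastic 3 (-2) 0, Plastic 2 1 0]"
    by code_simp
  ultimately show ?thesis using n by auto
qed

section \<open>Rational 3-cycles\<close>

text \<open>Reduced fractions agree up to a common sign; absolute values are taken because
  \<open>q\<close> may be negative.\<close>

lemma abs_num_of_int_divide:
  assumes "coprime p q" "q \<noteq> 0"
  shows "\<bar>num (of_int p / of_int q)\<bar> = \<bar>p\<bar>"
proof -
  obtain n d where nd: "quotient_of (of_int p / of_int q) = (n, d)" by (metis surj_pair)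
  then have "of_int p / of_int q = (of_int n / of_int d :: rat)" "d > 0" "coprime n d"
    by (auto dest: quotient_of_div quotient_of_denom_pos quotient_of_coprime)
  moreover from this have "p * d = n * q"
    using assms by (simp add: frac_eq_eq flip: of_int_mult)
  then have "\<bar>p\<bar> * \<bar>d\<bar> = \<bar>n\<bar> * \<bar>q\<bar>" by (metis abs_mult)
  ultimately have "\<bar>p\<bar> = \<bar>n\<bar>"
    using assms coprime_crossproduct_int[of p q n d] by blast
  then show ?thesis by (simp add: num_def nd)
qed

lemma rat_3cycle_rotate: "rat_3cycle c x y z \<Longrightarrow> rat_3cycle c y z x"
  by (auto simp: rat_3cycle_def)

text \<open>With \<open>\<sigma> = y + z\<close> and \<open>\<rho> = z + x\<close>, subtracting consecutive cycle equations gives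
  \<open>1 + \<tau> + \<tau> \<sigma> = 0\<close> and \<open>\<tau> \<sigma> \<rho> = 1\<close>.\<close>

lemma rat_3cycle_parametrization:
  assumes "rat_3cycle c x y z"
  defines "\<tau> \<equiv> x + y"
  shows "\<tau> \<noteq> 0" "\<tau> \<noteq> -1" "y = (\<tau> ^ 3 - \<tau> - 1) / (2 * \<tau> * (\<tau> + 1))"
    "c = - (\<tau> ^ 6 + 2 * \<tau> ^ 5 + 4 * \<tau> ^ 4 + 8 * \<tau> ^ 3 + 9 * \<tau> ^ 2 + 4 * \<tau> + 1) / (4 * \<tau> ^ 2 * (\<tau> + 1) ^ 2)"
proof -
  have ne: "x \<noteq> y" "y \<noteq> z" "x \<noteq> z" and cyc: "x ^ 2 + c = y" "y ^ 2 + c = z" "z ^ 2 + c = x"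
    using assms by (auto simp: rat_3cycle_def fc_def)
  have "y - z = (x ^ 2 + c) - (y ^ 2 + c)" by (simp only: cyc)
  then have d1: "y - z = \<tau> * (x - y)" unfolding \<tau>_def by algebra
  have "z - x = (y ^ 2 + c) - (z ^ 2 + c)" by (simp only: cyc)
  then have d2: "z - x = (y + z) * (y - z)" by algebra
  have "x - y = (z ^ 2 + c) - (x ^ 2 + c)" by (simp only: cyc)
  then have d3: "x - y = (z + x) * (z - x)" by algebra
  show t0: "\<tau> \<noteq> 0" using d1 ne by auto
  \<comment> \<open>The successive differences are \<open>x - y\<close> times 1, \<tau> and \<tau>
    \<sigma>, and they sum to 0; going once round the cycle multiplies by \<tau> \<sigma>
    \<rho>.\<close>
  have "(x - y) * (1 + \<tau> + \<tau> * (y + z)) = 0" using d1 d2 d3 by algebra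
  then have s: "1 + \<tau> + \<tau> * (y + z) = 0" using ne by simp
  have "(x - y) * (\<tau> * (y + z) * (z + x) - 1) = 0" using d1 d2 d3 by algebra
  then have r: "\<tau> * (y + z) * (z + x) = 1" using ne by simp
  show t1: "\<tau> \<noteq> -1" using s r by auto
  \<comment> \<open>With \<sigma> = -(\<tau> + 1) / \<tau> and \<rho> = -1 / (\<tau> + 1), this
    depends on \<tau> alone.\<close>
  have "2 * y = \<tau> + (y + z) - (z + x)" by (simp add: \<tau>_def)
  with s r have y: "y * (2 * \<tau> * (\<tau> + 1)) = \<tau> ^ 3 - \<tau> - 1" by algebra
  then show "y = (\<tau> ^ 3 - \<tau> - 1) / (2 * \<tau> * (\<tau> + 1))"
    using t0 t1 by (simp add: eq_divide_eq add_eq_0_iff2)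
  have c: "c = (y + z) - y - y ^ 2" using cyc by simp
  have "c * (4 * \<tau> ^ 2 * (\<tau> + 1) ^ 2)
      = - (\<tau> ^ 6 + 2 * \<tau> ^ 5 + 4 * \<tau> ^ 4 + 8 * \<tau> ^ 3 + 9 * \<tau> ^ 2 + 4 * \<tau> + 1)"
    using s y c by algebra
  then show "c = - (\<tau> ^ 6 + 2 * \<tau> ^ 5 + 4 * \<tau> ^ 4 + 8 * \<tau> ^ 3 + 9 * \<tau> ^ 2 + 4 * \<tau> + 1)
      / (4 * \<tau> ^ 2 * (\<tau> + 1) ^ 2)"
    using t0 t1 by (simp add: eq_divide_eq add_eq_0_iff2)
qed

text \<open>The form is congruent to -b^3 modulo a, to a^3 modulo b and to -b^3 modulo a + b, and it
  is odd unless a and b are both even. A common prime would therefore divide both a and b.\<close>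

lemma coprime_thue_denominator:
  fixes a b :: int
  assumes "coprime a b"
  shows "coprime (a ^ 3 - a * b ^ 2 - b ^ 3) (2 * a * b * (a + b))" (is "coprime ?F _")
proof (rule ccontr)
  assume "\<not> coprime ?F (2 * a * b * (a + b))"
  then have "\<not> is_unit (gcd ?F (2 * a * b * (a + b)))"
    by (simp add: coprime_iff_gcd_eq_1)
  then obtain q where q: "prime q" "q dvd ?F" "q dvd 2 * a * b * (a + b)"
  proof (cases "gcd ?F (2 * a * b * (a + b)) = 0")
    case True
    then show ?thesis using that[of 2] by simp
  next
    case False
    then show ?thesis
      using prime_divisor_exists[OF False \<open>\<not> is_unit _\<close>] that by auto
  qed
  have "q dvd a \<and> q dvd b"
  proof -
    consider "q dvd a" | "q dvd b" | "q dvd a + b" | "q dvd 2"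
      using q by (auto simp: prime_dvd_mult_iff)
    then show ?thesis
    proof cases
      case 1
      moreover have "b ^ 3 = a * (a ^ 2 - b ^ 2) - ?F" by algebra
      ultimately have "q dvd b ^ 3" using q by (metis dvd_diff dvd_mult2)
      then show ?thesis using 1 q by (auto dest: prime_dvd_power)
    next
      case 2
      moreover have "a ^ 3 = b * (a * b + b ^ 2) + ?F" by algebra
      ultimately have "q dvd a ^ 3" using q by (metis dvd_add dvd_mult2)
      then show ?thesis using 2 q by (auto dest: prime_dvd_power)
    next
      case 3
      moreover have "b ^ 3 = (a + b) * (a * (a - b)) - ?F" by algebra
      ultimately have "q dvd b ^ 3" using q by (metis dvd_diff dvd_mult2)
      then have "q dvd b" using q by (auto dest: prime_dvd_power)
      then show ?thesis using 3 by (simp add: dvd_add_left_iff)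
    next
      case 4
      then have "q = 2" using q by (intro primes_dvd_imp_eq) auto
      then show ?thesis using q(2) by auto
    qed
  qed
  then show False using q assms by (metis coprime_common_divisor not_prime_unit)
qed

text \<open>A rotation puts the element with the given numerator in the place of \<open>y\<close>,
  whose reduced fraction has numerator \<plusminus>F. The nonvanishing conditions later discard the
  degenerate Thue solutions.\<close>

lemma cycle_has_num_thue:
  assumes "cycle_has_num c m"
  obtains a b :: int where "a ^ 3 - a * b ^ 2 - b ^ 3 = m" "a \<noteq> 0" "b \<noteq> 0" "a + b \<noteq> 0"
    "c = - of_int (a ^ 6 + 2 * a ^ 5 * b + 4 * a ^ 4 * b ^ 2 + 8 * a ^ 3 * b ^ 3 + 9 * a ^ 2 * b ^ 4
        + 4 * a * b ^ 5 + b ^ 6) / of_int (4 * a ^ 2 * b ^ 2 * (a + b) ^ 2)"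
proof -
  obtain x y z where cyc: "rat_3cycle c x y z" and y: "\<bar>num y\<bar> = m"
    using assms rat_3cycle_rotate unfolding cycle_has_num_def by blast
  obtain a b where ab: "quotient_of (x + y) = (a, b)" by (metis surj_pair)
  then have t: "x + y = of_int a / of_int b" and b: "b > 0" and "coprime a b"
    by (auto dest: quotient_of_div quotient_of_denom_pos quotient_of_coprime)
  define F where "F = a ^ 3 - a * b ^ 2 - b ^ 3"
  note par = rat_3cycle_parametrization[OF cyc, unfolded t]
  have a: "a \<noteq> 0" using par(1) by auto
  have "rat_of_int (a + b) \<noteq> 0"
    using par(2) b by (auto simp: field_simps add_eq_0_iff)
  then have ab0: "a + b \<noteq> 0" by (metis of_int_0)
  have nz: "rat_of_int a \<noteq> 0" "rat_of_int b \<noteq> 0" "rat_of_int a + of_int b \<noteq> 0"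
    using a b \<open>rat_of_int (a + b) \<noteq> 0\<close> by auto
  have sum: "of_int a / of_int b + 1 = (of_int a + of_int b) / rat_of_int b"
    using nz by (simp add: field_simps)
  have "y = of_int F / of_int (2 * a * b * (a + b))"
    unfolding par(3) sum using nz
    by (simp add: F_def divide_simps power2_eq_square power3_eq_cube)
  then have F: "\<bar>F\<bar> = m"
    using abs_num_of_int_divide coprime_thue_denominator[OF \<open>coprime a b\<close>] y a b ab0
    by (metis F_def mult_eq_0_iff less_irrefl zero_neq_numeral)
  have c: "c = - of_int (a ^ 6 + 2 * a ^ 5 * b + 4 * a ^ 4 * b ^ 2 + 8 * a ^ 3 * b ^ 3 + 9 * a ^ 2 * b ^ 4
        + 4 * a * b ^ 5 + b ^ 6) / of_int (4 * a ^ 2 * b ^ 2 * (a + b) ^ 2)"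
  proof -
    define T where "T = rat_of_int a / of_int b"
    have T: "rat_of_int a = T * of_int b" using nz by (simp add: T_def)
    have "c = - (T ^ 6 + 2 * T ^ 5 + 4 * T ^ 4 + 8 * T ^ 3 + 9 * T ^ 2 + 4 * T + 1)
        / (4 * T ^ 2 * (T + 1) ^ 2)"
      using par(4) by (simp only: T_def)
    also have "\<dots> = (rat_of_int b ^ 6
          * - (T ^ 6 + 2 * T ^ 5 + 4 * T ^ 4 + 8 * T ^ 3 + 9 * T ^ 2 + 4 * T + 1))
        / (rat_of_int b ^ 6 * (4 * T ^ 2 * (T + 1) ^ 2))"
      using nz by (intro mult_divide_mult_cancel_left[symmetric]) simp
    also have "rat_of_int b ^ 6
          * - (T ^ 6 + 2 * T ^ 5 + 4 * T ^ 4 + 8 * T ^ 3 + 9 * T ^ 2 + 4 * T + 1)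
        = - of_int (a ^ 6 + 2 * a ^ 5 * b + 4 * a ^ 4 * b ^ 2 + 8 * a ^ 3 * b ^ 3
            + 9 * a ^ 2 * b ^ 4 + 4 * a * b ^ 5 + b ^ 6)"
      unfolding of_int_add of_int_mult of_int_power of_int_numeral T by algebra
    also have "rat_of_int b ^ 6 * (4 * T ^ 2 * (T + 1) ^ 2)
        = of_int (4 * a ^ 2 * b ^ 2 * (a + b) ^ 2)"
      unfolding of_int_add of_int_mult of_int_power of_int_numeral T by algebra
    finally show ?thesis .
  qed
  show ?thesis
  proof (cases "F \<ge> 0")
    case True
    then show ?thesis using that[of a b] F a b ab0 c by (simp add: F_def)
  next
    case False
    \<comment> \<open>Negating \<open>a\<close> and \<open>b\<close> changes the sign of the cubic
      form but not \<open>c\<close>, a quotient of forms of degree 6.\<close>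
    have "(- a - b) ^ 2 = (a + b) ^ 2" by algebra
    then show ?thesis using that[of "- a" "- b"] False F a b ab0 c by (simp add: F_def)
  qed
qed

lemma cycle_has_numI:
  assumes "coprime p q" "q \<noteq> 0" "\<bar>p\<bar> = m" "rat_3cycle c (of_int p / of_int q) y z"
  shows "cycle_has_num c m"
  using assms abs_num_of_int_divide[of p q] unfolding cycle_has_num_def by blast

theorem theorem7:
  fixes c :: rat
  shows "(cycle_has_num c 1 \<longleftrightarrow>
            c \<in> {- 29 / 16, - (29 * 1709) / (2^6 * 3^2 * 7^2)})
       \<and> (cycle_has_num c 5 \<longleftrightarrow> c \<in> {- 29 / 16, - 301 / (2^4 * 3^2)})
       \<and> (cycle_has_num c 7 \<longleftrightarrow> c \<in> {- 29 / 16, - 6469 / (2^4 * 3^2 * 5^2)})"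
proof (intro conjI iffI)
  \<comment> \<open>This cycle has numerators of absolute value 1, 7 and 5, which is why -29/16
    occurs in all three parts.\<close>
  have cycle: "rat_3cycle (- 29 / 16) (- 1 / 4) (- 7 / 4) (5 / 4)"
    by (simp add: rat_3cycle_def fc_def power2_eq_square)
  then have cycles: "rat_3cycle (- 29 / 16) (- 7 / 4) (5 / 4) (- 1 / 4)"
      "rat_3cycle (- 29 / 16) (5 / 4) (- 1 / 4) (- 7 / 4)"
    by (auto dest: rat_3cycle_rotate)
  have coprimes: "coprime (5::int) 4" "coprime (5::int) 12" "coprime (7::int) 4" "coprime (7::int) 60"
    by code_simp+
  {
    assume "cycle_has_num c 1"
    then show "c \<in> {- 29 / 16, - (29 * 1709) / (2^6 * 3^2 * 7^2)}"
      by (rule cycle_has_num_thue) (drule thue_1, auto)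
  next
    assume "c \<in> {- 29 / 16, - (29 * 1709) / (2^6 * 3^2 * 7^2)}"
    \<comment> \<open>The starting points 1/168, and below 5/12 and 7/60, are F / (2ab(a + b)) at
      (a, b) = (4, 3), (2, 1) and (3, 2).\<close>
    then show "cycle_has_num c 1"
      using cycle cycle_has_numI[of "- 1" 4 1 c "- 7 / 4" "5 / 4"]
        cycle_has_numI[of 1 168 1 c "- 295 / 168" "223 / 168"]
      by (auto simp: rat_3cycle_def fc_def power2_eq_square)
  next
    assume "cycle_has_num c 5"
    then show "c \<in> {- 29 / 16, - 301 / (2^4 * 3^2)}"
      by (rule cycle_has_num_thue) (drule thue_5, auto)
  next
    assume "c \<in> {- 29 / 16, - 301 / (2^4 * 3^2)}"
    then show "cycle_has_num c 5"
      using cycles coprimes cycle_has_numI[of 5 4 5 c "- 1 / 4" "- 7 / 4"]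
        cycle_has_numI[of 5 12 5 c "- 23 / 12" "19 / 12"]
      by (auto simp: rat_3cycle_def fc_def power2_eq_square)
  next
    assume "cycle_has_num c 7"
    then show "c \<in> {- 29 / 16, - 6469 / (2^4 * 3^2 * 5^2)}"
      by (rule cycle_has_num_thue) (drule thue_7, auto)
  next
    assume "c \<in> {- 29 / 16, - 6469 / (2^4 * 3^2 * 5^2)}"
    then show "cycle_has_num c 7"
      using cycles coprimes cycle_has_numI[of "- 7" 4 7 c "5 / 4" "- 1 / 4"]
        cycle_has_numI[of 7 60 7 c "- 107 / 60" "83 / 60"]
      by (auto simp: rat_3cycle_def fc_def power2_eq_square)
  }
qed

end
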